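(* Let $L$ be an irreducible almost lower-triangular transition matrix on $\mathbb N$ and let $Y=(Y_i,i\ge0)$ be a Markov chain with transition matrix $L$. For integers $0<x<b$ set $$v_b(x)=\mathbb P\big(\tau_{\{0\}}(Y)>\tau_{\{b\}}(Y)\,\big|\,Y_0=x\big).$$ Then $$v_b(x)=\frac{\det(\mathrm{Id}-L_{[1,x-1]})}{\det(\mathrm{Id}-L_{[1,b-1]})}\prod_{j=x}^{b-1}L_{j,j+1},$$ and $L$ is recurrent if and only if $$\lim_{b\to+\infty}v_b(1)=\lim_{b\to+\infty}\frac{\prod_{j=1}^{b-1}L_{j,j+1}}{\det(\mathrm{Id}-L_{[1,b-1]})}=0 .$$
   Context: $\mathbb N=\{0,1,2,\dots\}$. A transition matrix $L=[L_{i,j}]_{i,j\ge0}$ on $\mathbb N$ (non-negative entries, rows summing to $1$) is almost lower-triangular if $L_{i,j}>0\Rightarrow j\le i+1$. $\tau_S(Y)=\inf\{j>0:Y_j\in S\}$. $L_{[a,b]}=[L_{i,j}]_{a\le i,j\le b}$, $\mathrm{Id}$ is the identity matrix of the appropriate size, and the determinant of an empty matrix is $1$. *)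

theory Defs
  imports "HOL-Probability.Probability" "Jordan_Normal_Form.Determinant"
begin

definition transition_matrix :: "(nat \<Rightarrow> nat \<Rightarrow> real) \<Rightarrow> bool" where
  "transition_matrix L \<longleftrightarrow> (\<forall>i j. 0 \<le> L i j) \<and> (\<forall>i. (\<lambda>j. L i j) sums 1)"

definition almost_lower_triangular :: "(nat \<Rightarrow> nat \<Rightarrow> real) \<Rightarrow> bool" where
  "almost_lower_triangular L \<longleftrightarrow> (\<forall>i j. L i j > 0 \<longrightarrow> j \<le> i + 1)"

fun matrix_power :: "(nat \<Rightarrow> nat \<Rightarrow> real) \<Rightarrow> nat \<Rightarrow> nat \<Rightarrow> nat \<Rightarrow> real" where
  "matrix_power L 0 i j = (if i = j then 1 else 0)"
| "matrix_power L (Suc n) i j = (\<Sum>k. L i k * matrix_power L n k j)"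

definition irreducible_matrix :: "(nat \<Rightarrow> nat \<Rightarrow> real) \<Rightarrow> bool" where
  "irreducible_matrix L \<longleftrightarrow> (\<forall>i j. \<exists>n. matrix_power L n i j > 0)"

text \<open>\<open>index_block L a b\<close> is the block \<open>[L i j]\<close> with \<open>a \<le> i, j \<le> b\<close>, reindexed from \<open>0\<close>.
  It is the \<open>0 \<times> 0\<close> matrix, of determinant \<open>1\<close>, when \<open>b + 1 = a\<close>.\<close>

definition index_block :: "(nat \<Rightarrow> nat \<Rightarrow> real) \<Rightarrow> nat \<Rightarrow> nat \<Rightarrow> real mat" where
  "index_block L a b = mat (b + 1 - a) (b + 1 - a) (\<lambda>(i, j). L (a + i) (a + j))"

definition det_Id_minus_block :: "(nat \<Rightarrow> nat \<Rightarrow> real) \<Rightarrow> nat \<Rightarrow> nat \<Rightarrow> real" where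
  "det_Id_minus_block L a b = Determinant.det (1\<^sub>m (b + 1 - a) - index_block L a b)"

text \<open>The initial distribution of a Markov chain is arbitrary.\<close>

definition markov_chain ::
    "(nat \<Rightarrow> nat \<Rightarrow> real) \<Rightarrow> 'a measure \<Rightarrow> (nat \<Rightarrow> 'a \<Rightarrow> nat) \<Rightarrow> bool" where
  "markov_chain L M Y \<longleftrightarrow>
     prob_space M \<and> (\<forall>n. Y n \<in> measurable M (count_space UNIV)) \<and>
     (\<forall>n s. \<P>(\<omega> in M. \<forall>k\<le>n. Y k \<omega> = s k) > 0 \<longrightarrow>
        \<P>(\<omega> in M. Y (Suc n) \<omega> = s (Suc n) \<bar> \<forall>k\<le>n. Y k \<omega> = s k) = L (s n) (s (Suc n)))"

text \<open>The infimum of the empty set is \<open>\<infinity>\<close>.\<close>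

definition hitting_time :: "nat set \<Rightarrow> (nat \<Rightarrow> nat) \<Rightarrow> enat" where
  "hitting_time S y = Inf {enat j | j. j > 0 \<and> y j \<in> S}"

definition exit_prob :: "'a measure \<Rightarrow> (nat \<Rightarrow> 'a \<Rightarrow> nat) \<Rightarrow> nat \<Rightarrow> nat \<Rightarrow> real" where
  "exit_prob M Y b x =
     \<P>(\<omega> in M. hitting_time {0} (\<lambda>n. Y n \<omega>) > hitting_time {b} (\<lambda>n. Y n \<omega>) \<bar> Y 0 \<omega> = x)"

text \<open>The law \<open>P\<^sub>x\<close> on path space of the chain with transition matrix \<open>L\<close> started at \<open>x\<close>, built
  from independent jumps: \<open>\<omega> (n, i)\<close> has law \<open>L i\<close> and is the state at time \<open>n + 1\<close> if the
  state at time \<open>n\<close> is \<open>i\<close>.\<close>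

fun chain_path :: "nat \<Rightarrow> (nat \<times> nat \<Rightarrow> nat) \<Rightarrow> nat \<Rightarrow> nat" where
  "chain_path x \<omega> 0 = x"
| "chain_path x \<omega> (Suc n) = \<omega> (n, chain_path x \<omega> n)"

definition jump_space :: "(nat \<Rightarrow> nat \<Rightarrow> real) \<Rightarrow> (nat \<times> nat \<Rightarrow> nat) measure" where
  "jump_space L = (\<Pi>\<^sub>M (n, i)\<in>UNIV. measure_pmf (embed_pmf (L i)))"

definition chain_law :: "(nat \<Rightarrow> nat \<Rightarrow> real) \<Rightarrow> nat \<Rightarrow> (nat \<Rightarrow> nat) measure" where
  "chain_law L x = distr (jump_space L) (\<Pi>\<^sub>M n\<in>UNIV. count_space UNIV) (chain_path x)"

definition recurrent :: "(nat \<Rightarrow> nat \<Rightarrow> real) \<Rightarrow> bool" where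
  "recurrent L \<longleftrightarrow> (\<forall>i. \<P>(y in chain_law L i. hitting_time {i} y < \<infinity>) = 1)"

lemma pmf_row:
  assumes "transition_matrix L"
  shows "pmf (embed_pmf (L i)) j = L i j"
proof (rule pmf_embed_pmf)
  show "0 \<le> L i j" for j
    using assms by (auto simp: transition_matrix_def)
  have "(\<Sum>j. ennreal (L i j)) = ennreal 1"
    using assms by (intro suminf_ennreal_eq) (auto simp: transition_matrix_def)
  then show "(\<integral>\<^sup>+j. ennreal (L i j) \<partial>count_space UNIV) = 1"
    by (simp add: nn_integral_count_space_nat)
qed

lemma chain_path_eq_iff:
  "(\<forall>k\<le>n. chain_path x \<omega> k = s k) \<longleftrightarrow> s 0 = x \<and> (\<forall>k<n. \<omega> (k, s k) = s (Suc k))"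
proof (induction n)
  case (Suc n)
  then show ?case
    by (auto simp: le_Suc_eq less_Suc_eq)
qed auto

lemma sets_jump_space: "sets (jump_space L) = sets (\<Pi>\<^sub>M p\<in>UNIV. count_space UNIV)"
  unfolding jump_space_def by (intro sets_PiM_cong) auto

lemma measurable_chain_path_component [measurable]:
  "(\<lambda>\<omega>. chain_path x \<omega> n) \<in> measurable (jump_space L) (count_space UNIV)"
proof (induction n)
  case (Suc n)
  have [measurable]: "(\<lambda>\<omega>. \<omega> p) \<in> measurable (jump_space L) (count_space UNIV)" for p
    by (subst measurable_cong_sets[OF sets_jump_space refl]) (rule measurable_component_singleton, simp)
  note Suc.IH [measurable]
  show ?case
    unfolding chain_path.simps
    by (rule measurable_compose_countable[where g = "\<lambda>\<omega>. chain_path x \<omega> n"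
          and f = "\<lambda>i \<omega>. \<omega> (n, i)"]) measurable
qed auto

lemma measurable_chain_path:
  "chain_path x \<in> measurable (jump_space L) (\<Pi>\<^sub>M n\<in>UNIV. count_space UNIV)"
  by (rule measurable_PiM_single') (auto simp: space_PiM)

lemma space_jump_space: "space (jump_space L) = UNIV"
  using sets_eq_imp_space_eq[OF sets_jump_space] by (simp add: space_PiM)

lemma prob_space_chain_law: "prob_space (chain_law L x)"
  unfolding chain_law_def
proof (rule prob_space.prob_space_distr[OF _ measurable_chain_path])
  show "prob_space (jump_space L)"
    unfolding jump_space_def by (rule prob_space_PiM) (auto intro: measure_pmf.prob_space_axioms)
qed

lemma prob_chain_law_path:
  assumes "transition_matrix L"
  shows "\<P>(y in chain_law L x. \<forall>k\<le>n. y k = s k) =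
    (if s 0 = x then \<Prod>k<n. L (s k) (s (Suc k)) else 0)"
proof -
  have meas: "{y \<in> space (\<Pi>\<^sub>M n\<in>UNIV. count_space UNIV). \<forall>k\<le>n. y k = s k}
      \<in> sets (\<Pi>\<^sub>M n\<in>(UNIV::nat set). count_space (UNIV::nat set))"
    by measurable
  have eq: "\<P>(y in chain_law L x. \<forall>k\<le>n. y k = s k)
      = measure (jump_space L) {\<omega>. s 0 = x \<and> (\<forall>k<n. \<omega> (k, s k) = s (Suc k))}"
    unfolding chain_law_def space_distr
    by (subst measure_distr[OF measurable_chain_path meas])
       (auto simp: space_jump_space space_PiM chain_path_eq_iff vimage_def)
  show ?thesis
  proof (cases "s 0 = x")
    case True
    define N where "N = (\<lambda>p :: nat \<times> nat. measure_pmf (embed_pmf (L (snd p))))"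
    define J where "J = (\<lambda>k. (k, s k)) ` {..<n}"
    interpret product_prob_space N UNIV
      by (rule product_prob_spaceI) (simp add: N_def measure_pmf.prob_space_axioms)
    have jump: "jump_space L = PiM UNIV N"
      unfolding jump_space_def N_def by (intro arg_cong[where f = "PiM UNIV"]) auto
    have emb: "prod_emb UNIV N J (Pi\<^sub>E J (\<lambda>p. {s (Suc (fst p))}))
        = {\<omega>. \<forall>k<n. \<omega> (k, s k) = s (Suc k)}"
      by (auto simp: prod_emb_def J_def N_def Pi_iff)
    have "measure (PiM UNIV N) {\<omega>. \<forall>k<n. \<omega> (k, s k) = s (Suc k)}
        = (\<Prod>p\<in>J. measure (N p) {s (Suc (fst p))})"
      unfolding emb[symmetric] by (rule measure_PiM_emb) (auto simp: J_def N_def)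
    also have "\<dots> = (\<Prod>k<n. measure (N (k, s k)) {s (Suc k)})"
      unfolding J_def by (subst prod.reindex) (auto simp: inj_on_def)
    also have "\<dots> = (\<Prod>k<n. L (s k) (s (Suc k)))"
      unfolding N_def by (simp add: measure_pmf_single pmf_row[OF assms])
    finally show ?thesis
      using True by (simp add: eq jump)
  qed (simp add: eq)
qed

lemma markov_chain_chain_law:
  assumes "transition_matrix L"
  shows "markov_chain L (chain_law L x) (\<lambda>n y. y n)"
    and "\<P>(y in chain_law L x. y 0 = x) = 1"
proof -
  show "\<P>(y in chain_law L x. y 0 = x) = 1"
    using prob_chain_law_path[OF assms, of x 0 "\<lambda>_. x"] by simp
  have "\<P>(y in chain_law L x. y (Suc n) = s (Suc n) \<bar> \<forall>k\<le>n. y k = s k) = L (s n) (s (Suc n))"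
    if pos: "\<P>(y in chain_law L x. \<forall>k\<le>n. y k = s k) > 0" for n s
  proof -
    have "\<P>(y in chain_law L x. y (Suc n) = s (Suc n) \<and> (\<forall>k\<le>n. y k = s k))
        = \<P>(y in chain_law L x. \<forall>k\<le>Suc n. y k = s k)"
      by (intro arg_cong[where f = "measure _"]) (auto simp: le_Suc_eq)
    then show ?thesis
      using pos by (simp add: cond_prob_def prob_chain_law_path[OF assms] less_le
          split: if_splits del: prod_zero_iff)
  qed
  moreover have "(\<lambda>y. y n) \<in> measurable (chain_law L x) (count_space UNIV)" for n
    unfolding chain_law_def measurable_distr_eq1 by simp
  ultimately show "markov_chain L (chain_law L x) (\<lambda>n y. y n)"
    unfolding markov_chain_def using prob_space_chain_law by blast
qed

end

theory Submission
  imports Defs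
begin

text \<open>
  Everything rests on one function. Irreducibility and the almost lower-triangular shape force
  \<open>L j (j + 1) > 0\<close> for all \<open>j\<close>, so the equation \<open>h x = (\<Sum>z. L x z * h z)\<close> for \<open>x > 0\<close>, together
  with \<open>h 0 = 0\<close> and \<open>h 1 = 1\<close>, can be solved upwards and has exactly one solution \<open>h\<close>, called
  \<open>scale\<close> below. It is nondecreasing, hence positive away from \<open>0\<close>.

  The determinants are this function in disguise (\<open>det_eq_scale\<close>): \<open>Id - L\<^bsub>[1,n]\<^esub>\<close> maps
  the vector \<open>(h 1, \<dots>, h n)\<close> to a multiple of the last unit vector, and Cramer's rule for its first
  coordinate gives \<open>det (Id - L\<^bsub>[1,n]\<^esub>) = h (n + 1) * (\<Prod>j=1..n. L j (j + 1))\<close>. So the determinants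
  are positive, and the claimed formula for the exit probability is \<open>h x / h b\<close>, with value
  \<open>1 / h b\<close> at \<open>x = 1\<close>.

  The exit probability is itself harmonic in \<open>0 < x < b\<close> with boundary values \<open>0\<close> and \<open>1\<close>, so it is
  \<open>h x / h b\<close> by the maximum principle. The maximum principle is simple here because a chain that
  can always move up by one carries an interior maximum up to \<open>b\<close> (\<open>maximum_moves_up\<close>).

  It remains to see that \<open>L\<close> is recurrent if and only if \<open>h\<close> is unbounded. If \<open>h \<le> H\<close>, then
  \<open>1 - h x / H\<close> bounds the probability of reaching \<open>0\<close> from \<open>x > 0\<close>, and the chain is not recurrent
  at \<open>0\<close>. If \<open>h\<close> is unbounded, fix a state \<open>i\<close> and let \<open>g x\<close> be the probability of
  never visiting \<open>i\<close> from \<open>x\<close>. Comparing \<open>g - g 0\<close> with \<open>\<epsilon> h\<close> on \<open>[0,b]\<close> for large \<open>b\<close>, and letting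
  \<open>\<epsilon>\<close> tend to \<open>0\<close>, shows that \<open>g\<close> is largest at \<open>0\<close>. This maximum moves up through all states
  and so is the value \<open>g i = 0\<close>. Thus \<open>i\<close> is reached almost surely from everywhere.
\<close>

section \<open>Hitting one set before another\<close>

text \<open>The finite-horizon form of "\<open>T\<close> is hit strictly before \<open>A\<close>". As for \<open>hitting_time\<close>, the state
  at time \<open>0\<close> is ignored. The choices \<open>T = {b}\<close>, \<open>A = {0}\<close> and \<open>T = {i}\<close>, \<open>A = {}\<close> give the exit
  event and the return event.\<close>

definition hits_within :: "nat set \<Rightarrow> nat set \<Rightarrow> nat \<Rightarrow> (nat \<Rightarrow> nat) \<Rightarrow> bool" where
  "hits_within T A n y \<longleftrightarrow> (\<exists>j. 0 < j \<and> j \<le> n \<and> y j \<in> T \<and> (\<forall>k. 0 < k \<and> k \<le> j \<longrightarrow> y k \<notin> A))"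

lemma hitting_time_less_iff:
  "hitting_time T y < hitting_time A y \<longleftrightarrow> (\<exists>n. hits_within T A n y)"
proof
  assume "hitting_time T y < hitting_time A y"
  then obtain j where j: "j > 0" "y j \<in> T" "enat j < hitting_time A y"
    unfolding hitting_time_def[of T] by (auto simp: Inf_less_iff)
  have "y k \<notin> A" if "0 < k" "k \<le> j" for k
  proof
    assume "y k \<in> A"
    then have "hitting_time A y \<le> enat k"
      using that unfolding hitting_time_def by (intro Inf_lower) auto
    then show False
      using j(3) that(2) by (meson enat_ord_simps(1) leD order_trans)
  qed
  with j show "\<exists>n. hits_within T A n y"
    unfolding hits_within_def by blast
next
  assume "\<exists>n. hits_within T A n y"
  then obtain j where j: "j > 0" "y j \<in> T" "\<And>k. 0 < k \<Longrightarrow> k \<le> j \<Longrightarrow> y k \<notin> A"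
    unfolding hits_within_def by blast
  have "hitting_time T y \<le> enat j"
    using j unfolding hitting_time_def by (intro Inf_lower) auto
  also have "enat j < enat (Suc j)"
    by simp
  also have "enat (Suc j) \<le> hitting_time A y"
    unfolding hitting_time_def
  proof (rule Inf_greatest)
    fix e assume "e \<in> {enat j | j. j > 0 \<and> y j \<in> A}"
    then show "enat (Suc j) \<le> e"
      using j(3) by (auto simp: not_less_eq_eq[symmetric])
  qed
  finally show "hitting_time T y < hitting_time A y" .
qed

lemma hits_within_mono: "m \<le> n \<Longrightarrow> hits_within T A m y \<Longrightarrow> hits_within T A n y"
  unfolding hits_within_def by (meson order_trans)

lemma hits_within_Suc:
  "hits_within T A (Suc n) y \<longleftrightarrow>
     y 1 \<notin> A \<and> (y 1 \<in> T \<or> hits_within T A n (\<lambda>k. y (Suc k)))"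
  (is "?l \<longleftrightarrow> ?r")
proof
  assume ?l
  then obtain j where j: "0 < j" "j \<le> Suc n" "y j \<in> T" "\<And>k. 0 < k \<Longrightarrow> k \<le> j \<Longrightarrow> y k \<notin> A"
    unfolding hits_within_def by blast
  show ?r
  proof (cases "j = 1")
    case False
    then have "0 < j - 1" "j - 1 \<le> n" "y (Suc (j - 1)) \<in> T"
      "\<And>k. 0 < k \<Longrightarrow> k \<le> j - 1 \<Longrightarrow> y (Suc k) \<notin> A"
      using j by auto
    then have "hits_within T A n (\<lambda>k. y (Suc k))"
      unfolding hits_within_def by blast
    then show ?thesis
      using j(1) j(4)[of 1] by simp
  qed (use j in auto)
next
  assume r: ?r
  show ?l
  proof (cases "y 1 \<in> T")
    case True
    then show ?thesis
      using r unfolding hits_within_def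
      by (intro exI[of _ 1]) (auto simp: le_Suc_eq)
  next
    case False
    then obtain j where j: "0 < j" "j \<le> n" "y (Suc j) \<in> T"
        "\<And>k. 0 < k \<Longrightarrow> k \<le> j \<Longrightarrow> y (Suc k) \<notin> A"
      using r unfolding hits_within_def by blast
    have "y k \<notin> A" if "0 < k" "k \<le> Suc j" for k
      using r j(4)[of "k - 1"] that by (cases "k = 1") auto
    then show ?thesis
      using j unfolding hits_within_def by (intro exI[of _ "Suc j"]) auto
  qed
qed

fun hit_prob :: "(nat \<Rightarrow> nat \<Rightarrow> real) \<Rightarrow> nat set \<Rightarrow> nat set \<Rightarrow> nat \<Rightarrow> nat \<Rightarrow> real" where
  "hit_prob L T A 0 x = 0"
| "hit_prob L T A (Suc n) x =
     (\<Sum>z. L x z * (if z \<in> A then 0 else if z \<in> T then 1 else hit_prob L T A n z))"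

text \<open>Conditioning on the next state. The history is a single trajectory, so the defining property
  of a Markov chain applies directly, and the hypothesis for \<open>n\<close> is used for each of its one-step
  extensions \<open>s(Suc m := z)\<close>.\<close>

lemma prob_hits_within:
  assumes "markov_chain L M Y"
  shows "\<P>(\<omega> in M. (\<forall>k\<le>m. Y k \<omega> = s k) \<and> hits_within T A n (\<lambda>k. Y (m + k) \<omega>)) =
    \<P>(\<omega> in M. \<forall>k\<le>m. Y k \<omega> = s k) * hit_prob L T A n (s m)"
proof (induction n arbitrary: m s)
  case 0
  then show ?case
    by (simp add: hits_within_def)
next
  case (Suc n)
  interpret prob_space M
    using assms by (simp add: markov_chain_def)
  have [measurable]: "Y k \<in> measurable M (count_space UNIV)" for k
    using assms by (simp add: markov_chain_def)
  let ?E = "\<lambda>\<omega>. \<forall>k\<le>m. Y k \<omega> = s k"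
  let ?H = "\<lambda>\<omega>. hits_within T A (Suc n) (\<lambda>k. Y (m + k) \<omega>)"
  define w where "w = (\<lambda>z. if z \<in> A then 0 else if z \<in> T then 1 else hit_prob L T A n z)"
  have ext: "?E \<omega> \<and> Y (Suc m) \<omega> = z \<longleftrightarrow> (\<forall>k\<le>Suc m. Y k \<omega> = (s(Suc m := z)) k)" for \<omega> z
    by (auto simp: le_Suc_eq)
  have step: "prob {\<omega> \<in> space M. ?E \<omega> \<and> Y (Suc m) \<omega> = z} =
      prob {\<omega> \<in> space M. ?E \<omega>} * L (s m) z" for z
  proof (cases "prob {\<omega> \<in> space M. ?E \<omega>} > 0")
    case True
    define s' where "s' = s(Suc m := z)"
    have s': "(\<forall>k\<le>m. Y k \<omega> = s' k) \<longleftrightarrow> ?E \<omega>" "s' m = s m" "s' (Suc m) = z" for \<omega>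
      by (auto simp: s'_def)
    have "\<P>(\<omega> in M. Y (Suc m) \<omega> = s' (Suc m) \<bar> \<forall>k\<le>m. Y k \<omega> = s' k) = L (s' m) (s' (Suc m))"
      using assms True unfolding markov_chain_def s'(1)[symmetric] by blast
    then have "\<P>(\<omega> in M. Y (Suc m) \<omega> = z \<bar> ?E \<omega>) = L (s m) z"
      by (simp add: s')
    then show ?thesis
      using True by (simp add: cond_prob_def field_simps conj_commute)
  next
    case False
    then have 0: "prob {\<omega> \<in> space M. ?E \<omega>} = 0"
      using measure_nonneg[of M "{\<omega> \<in> space M. ?E \<omega>}"] by linarith
    have "prob {\<omega> \<in> space M. ?E \<omega> \<and> Y (Suc m) \<omega> = z} \<le> prob {\<omega> \<in> space M. ?E \<omega>}"
      by (intro finite_measure_mono) auto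
    then show ?thesis
      using 0 by (simp add: measure_le_0_iff)
  qed
  have contribution: "prob {\<omega> \<in> space M. ?E \<omega> \<and> Y (Suc m) \<omega> = z \<and> ?H \<omega>} =
      prob {\<omega> \<in> space M. ?E \<omega>} * (L (s m) z * w z)" for z
  proof -
    have eq: "?E \<omega> \<and> Y (Suc m) \<omega> = z \<and> ?H \<omega> \<longleftrightarrow>
        z \<notin> A \<and> (?E \<omega> \<and> Y (Suc m) \<omega> = z) \<and>
          (z \<in> T \<or> hits_within T A n (\<lambda>k. Y (Suc m + k) \<omega>))" for \<omega>
      by (auto simp: hits_within_Suc)
    show ?thesis
    proof (cases "z \<in> A \<or> z \<in> T")
      case True
      then show ?thesis
        unfolding eq by (auto simp: w_def step)
    next
      case False
      have "prob {\<omega> \<in> space M. (\<forall>k\<le>Suc m. Y k \<omega> = (s(Suc m := z)) k) \<and>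
              hits_within T A n (\<lambda>k. Y (Suc m + k) \<omega>)} =
          prob {\<omega> \<in> space M. \<forall>k\<le>Suc m. Y k \<omega> = (s(Suc m := z)) k} *
            hit_prob L T A n ((s(Suc m := z)) (Suc m))"
        by (rule Suc.IH)
      then show ?thesis
        using False unfolding eq unfolding ext[symmetric] by (simp add: w_def step)
    qed
  qed
  have "(\<lambda>z. prob {\<omega> \<in> space M. ?E \<omega> \<and> Y (Suc m) \<omega> = z \<and> ?H \<omega>}) sums
      prob {\<omega> \<in> space M. ?E \<omega> \<and> ?H \<omega>}"
    by (rule prob_sums) (auto simp: hits_within_def)
  then have sums: "(\<lambda>z. prob {\<omega> \<in> space M. ?E \<omega>} * (L (s m) z * w z)) sums
      prob {\<omega> \<in> space M. ?E \<omega> \<and> ?H \<omega>}"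
    unfolding contribution .
  have hp: "hit_prob L T A (Suc n) (s m) = (\<Sum>z. L (s m) z * w z)"
    by (simp add: w_def)
  show ?case
  proof (cases "prob {\<omega> \<in> space M. ?E \<omega>} = 0")
    case True
    then have "prob {\<omega> \<in> space M. ?E \<omega> \<and> ?H \<omega>} = 0"
      using sums_unique2[OF sums] by simp
    then show ?thesis
      using True by simp
  next
    case False
    then have "(\<lambda>z. L (s m) z * w z) sums
        (prob {\<omega> \<in> space M. ?E \<omega> \<and> ?H \<omega>} / prob {\<omega> \<in> space M. ?E \<omega>})"
      using sums_divide[OF sums, of "prob {\<omega> \<in> space M. ?E \<omega>}"] by simp
    then show ?thesis
      using False unfolding hp by (simp add: sums_iff)
  qed
qed

text \<open>The chain started at \<open>x\<close> in path space is used so that the probability exists for every \<open>x\<close>,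
  also for those that a given chain avoids at time \<open>0\<close>.\<close>

definition hitting_probability :: "(nat \<Rightarrow> nat \<Rightarrow> real) \<Rightarrow> nat set \<Rightarrow> nat set \<Rightarrow> nat \<Rightarrow> real" where
  "hitting_probability L T A x = \<P>(y in chain_law L x. hitting_time T y < hitting_time A y)"

text \<open>The finite-horizon events increase to the event itself. The limit does not depend on the chain,
  which is what transfers results from the canonical path space to an arbitrary realisation.\<close>

lemma hit_prob_tendsto_cond_prob:
  assumes "markov_chain L M Y" and pos: "\<P>(\<omega> in M. Y 0 \<omega> = x) > 0"
  shows "(\<lambda>n. hit_prob L T A n x) \<longlonglongrightarrow>
    \<P>(\<omega> in M. hitting_time T (\<lambda>n. Y n \<omega>) < hitting_time A (\<lambda>n. Y n \<omega>) \<bar> Y 0 \<omega> = x)"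
proof -
  interpret prob_space M
    using assms by (simp add: markov_chain_def)
  have [measurable]: "Y k \<in> measurable M (count_space UNIV)" for k
    using assms by (simp add: markov_chain_def)
  define B where "B = (\<lambda>n. {\<omega> \<in> space M. Y 0 \<omega> = x \<and> hits_within T A n (\<lambda>k. Y k \<omega>)})"
  have B: "prob (B n) = prob {\<omega> \<in> space M. Y 0 \<omega> = x} * hit_prob L T A n x" for n
    using prob_hits_within[OF assms(1), of 0 "\<lambda>_. x" T A n] by (simp add: B_def)
  have "(\<lambda>n. prob (B n)) \<longlonglongrightarrow> prob (\<Union>n. B n)"
  proof (rule finite_Lim_measure_incseq)
    show "range B \<subseteq> sets M"
      by (auto simp: B_def hits_within_def)
    show "incseq B"
      unfolding B_def incseq_def using hits_within_mono by blast
  qed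
  also have "(\<Union>n. B n) = {\<omega> \<in> space M. hitting_time T (\<lambda>n. Y n \<omega>) < hitting_time A (\<lambda>n. Y n \<omega>) \<and> Y 0 \<omega> = x}"
    by (auto simp: B_def hitting_time_less_iff)
  finally show ?thesis
    unfolding B cond_prob_def
    using pos tendsto_divide[OF _ tendsto_const, of _ _ _ "prob {\<omega> \<in> space M. Y 0 \<omega> = x}"]
    by fastforce
qed

lemma hit_prob_tendsto:
  assumes "transition_matrix L"
  shows "(\<lambda>n. hit_prob L T A n x) \<longlonglongrightarrow> hitting_probability L T A x"
proof -
  interpret prob_space "chain_law L x"
    by (rule prob_space_chain_law)
  have one: "prob {y \<in> space (chain_law L x). y 0 = x} = 1"
    using markov_chain_chain_law(2)[OF assms] .
  have [measurable]: "(\<lambda>y. y k) \<in> measurable (chain_law L x) (count_space UNIV)" for k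
    using markov_chain_chain_law(1)[OF assms, of x] by (simp add: markov_chain_def)
  have meas: "{y \<in> space (chain_law L x). hitting_time T y < hitting_time A y} \<in> events"
    unfolding hitting_time_less_iff hits_within_def by measurable
  have "AE y in chain_law L x. y 0 = x"
    using one by (subst (asm) prob_eq_1) (auto, measurable)
  then have "prob {y \<in> space (chain_law L x). hitting_time T y < hitting_time A y \<and> y 0 = x} =
      hitting_probability L T A x"
    unfolding hitting_probability_def using meas
    by (intro finite_measure_eq_AE) (auto)
  then show ?thesis
    using hit_prob_tendsto_cond_prob[OF markov_chain_chain_law(1)[OF assms], of x x T A] one
    by (simp add: cond_prob_def)
qed

lemma cond_prob_eq_hitting_probability:
  assumes "transition_matrix L" "markov_chain L M Y" "\<P>(\<omega> in M. Y 0 \<omega> = x) > 0"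
  shows "\<P>(\<omega> in M. hitting_time T (\<lambda>n. Y n \<omega>) < hitting_time A (\<lambda>n. Y n \<omega>) \<bar> Y 0 \<omega> = x) =
    hitting_probability L T A x"
  using LIMSEQ_unique[OF hit_prob_tendsto_cond_prob[OF assms(2,3)] hit_prob_tendsto[OF assms(1)]] .

lemma recurrent_iff:
  "recurrent L \<longleftrightarrow> (\<forall>i. hitting_probability L {i} {} i = 1)"
proof -
  have "hitting_time {} y = \<infinity>" for y
    by (simp add: hitting_time_def Inf_enat_def)
  then show ?thesis
    by (simp add: recurrent_def hitting_probability_def)
qed

section \<open>Chains that cannot skip upwards\<close>

locale upward_skip_free =
  fixes L :: "nat \<Rightarrow> nat \<Rightarrow> real"
  assumes transition: "transition_matrix L"
    and skip_free: "almost_lower_triangular L"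
    and up: "L i (Suc i) > 0"
begin

lemma nonneg: "L i j \<ge> 0"
  using transition by (simp add: transition_matrix_def)

lemma zero_above: "j > Suc i \<Longrightarrow> L i j = 0"
  using skip_free nonneg[of i j] unfolding almost_lower_triangular_def
  by (metis Suc_eq_plus1 leD less_eq_real_def)

lemma row_suminf: "(\<Sum>z. L x z * f z) = (\<Sum>z\<le>Suc x. L x z * f z)"
  by (rule suminf_finite) (auto simp: zero_above)

lemma row_sum: "(\<Sum>z\<le>Suc x. L x z) = 1"
proof -
  have "(\<Sum>z. L x z * 1) = 1"
    using transition by (simp add: transition_matrix_def sums_iff)
  then show ?thesis
    unfolding row_suminf by simp
qed

text \<open>A mean of values that do not exceed \<open>u x\<close> can reach \<open>u x\<close> only if every value of positive weight
  equals \<open>u x\<close>, and the weight of \<open>x + 1\<close> is positive.\<close>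

lemma maximum_moves_up:
  assumes max: "\<And>z. z \<le> Suc x \<Longrightarrow> u z \<le> u x"
    and sub: "u x \<le> (\<Sum>z\<le>Suc x. L x z * u z)"
  shows "u (Suc x) = u x"
proof -
  have "(\<Sum>z\<le>Suc x. L x z * (u x - u z)) = u x * (\<Sum>z\<le>Suc x. L x z) - (\<Sum>z\<le>Suc x. L x z * u z)"
    by (simp add: right_diff_distrib sum_subtractf sum_distrib_left mult_ac del: sum.atMost_Suc)
  also have "\<dots> \<le> 0"
    using sub unfolding row_sum by simp
  finally have "(\<Sum>z\<le>Suc x. L x z * (u x - u z)) \<le> 0" .
  moreover have "L x (Suc x) * (u x - u (Suc x)) \<le> (\<Sum>z\<le>Suc x. L x z * (u x - u z))"
    by (rule member_le_sum) (auto simp: nonneg max)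
  ultimately have "L x (Suc x) * (u x - u (Suc x)) \<le> 0"
    by linarith
  then have "u x \<le> u (Suc x)"
    using up[of x] by (simp add: mult_le_0_iff)
  then show ?thesis
    using max[of "Suc x"] by simp
qed

text \<open>An interior maximum is passed upwards until it reaches \<open>b\<close>.\<close>

lemma maximum_principle:
  assumes sub: "\<And>x. 0 < x \<Longrightarrow> x < b \<Longrightarrow> u x \<le> (\<Sum>z\<le>Suc x. L x z * u z)"
    and "u 0 \<le> c" "u b \<le> c" "x \<le> b"
  shows "u x \<le> c"
proof -
  obtain y where y: "y \<le> b" "\<And>z. z \<le> b \<Longrightarrow> u z \<le> u y"
  proof -
    have "Max (u ` {..b}) \<in> u ` {..b}"
      by (rule Max_in) auto
    then obtain y where "y \<le> b" "Max (u ` {..b}) = u y"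
      by (metis atMost_iff imageE)
    then show ?thesis
      using Max_ge[of "u ` {..b}"] by (intro that[of y]) auto
  qed
  have "u y \<le> c"
  proof (cases "y = 0")
    case False
    have "u b = u y"
      using y(1)
    proof (rule dec_induct)
      fix n assume n: "y \<le> n" "n < b" "u n = u y"
      have "u (Suc n) = u n"
        by (rule maximum_moves_up) (use n y(2) sub[of n] False in auto)
      then show "u (Suc n) = u y"
        using n by simp
    qed simp
    then show ?thesis
      using assms by simp
  qed (use assms in simp)
  then show ?thesis
    using y(2)[OF \<open>x \<le> b\<close>] by simp
qed

text \<open>The discrete analogue of the scale function of a diffusion: the equation of harmonicity at
  \<open>n + 1\<close> is solved for the value at \<open>n + 2\<close>, the highest state that one step can reach.\<close>

fun scale :: "nat \<Rightarrow> real" where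
  "scale 0 = 0"
| "scale (Suc 0) = 1"
| "scale (Suc (Suc n)) =
     (scale (Suc n) - (\<Sum>z\<le>Suc n. L (Suc n) z * scale z)) / L (Suc n) (Suc (Suc n))"

lemma scale_harmonic: "0 < x \<Longrightarrow> (\<Sum>z\<le>Suc x. L x z * scale z) = scale x"
  using up[of x] by (cases x) simp_all

text \<open>If \<open>scale\<close> is nondecreasing up to \<open>n\<close>, then the next states other than
  \<open>n + 1\<close> contribute at most \<open>(1 - L n (n + 1)) * scale n\<close> to the mean \<open>scale n\<close>, so the remaining value
  \<open>scale (n + 1)\<close> must be at least \<open>scale n\<close>.\<close>

lemma scale_mono: "mono scale"
proof -
  have "x \<le> n \<Longrightarrow> scale x \<le> scale n" for x n
  proof (induction n arbitrary: x)
    case (Suc n)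
    have "scale n \<le> scale (Suc n)"
    proof (cases n)
      case (Suc m)
      have "(\<Sum>z\<le>n. L n z * scale z) \<le> (\<Sum>z\<le>n. L n z * scale n)"
        using Suc.IH by (intro sum_mono mult_left_mono) (auto simp: nonneg)
      also have "\<dots> = (1 - L n (Suc n)) * scale n"
        using row_sum[of n] by (simp add: sum_distrib_right[symmetric])
      finally have "L n (Suc n) * scale n \<le> L n (Suc n) * scale (Suc n)"
        using scale_harmonic[of n] Suc by (simp add: algebra_simps)
      then show ?thesis
        using up[of n] by simp
    qed simp
    then show ?case
      using Suc.IH[of x] Suc.prems by (cases "x = Suc n") (auto simp del: scale.simps)
  qed simp
  then show ?thesis
    by (simp add: mono_def)
qed

lemma scale_ge_1: "0 < x \<Longrightarrow> 1 \<le> scale x"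
  using monoD[OF scale_mono, of 1 x] by simp

lemma scale_pos: "0 < x \<Longrightarrow> 0 < scale x"
  using scale_ge_1[of x] by simp

lemma scale_nonneg: "0 \<le> scale x"
  using scale_ge_1[of x] by (cases "x = 0") auto

section \<open>The determinants\<close>

text \<open>In \<open>A = Id - L\<^bsub>[1,n]\<^esub>\<close> the row of a state \<open>i < n\<close> expresses harmonicity at \<open>i\<close>, because the value
  at \<open>0\<close> is \<open>0\<close>; the row of \<open>n\<close> lacks the term of \<open>n + 1\<close>. So \<open>A\<close> maps \<open>(scale 1, \<dots>, scale n)\<close> to
  \<open>L n (n + 1) * scale (n + 1)\<close> times the last unit vector. By Cramer's rule, and since
  \<open>scale 1 = 1\<close>, the determinant of \<open>A\<close> does not change when its first column is replaced by this
  vector. The expansion along that column leaves a single minor, which is lower triangular with the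
  entries \<open>- L j (j + 1)\<close> on its diagonal.\<close>

lemma det_eq_scale:
  "det_Id_minus_block L 1 n = scale (Suc n) * (\<Prod>j=1..n. L j (j + 1))"
proof (cases "n = 0")
  case True
  then show ?thesis
    by (simp add: det_Id_minus_block_def index_block_def)
      (intro det_dim_zero, auto)
next
  case False
  define A where "A = 1\<^sub>m n - index_block L 1 n"
  define h where "h = vec n (\<lambda>i. scale (Suc i))"
  have A: "A \<in> carrier_mat n n"
    unfolding A_def index_block_def by (intro minus_carrier_mat) auto
  have A_entry: "A $$ (i, j) = (if i = j then 1 else 0) - L (Suc i) (Suc j)" if "i < n" "j < n" for i j
    using that by (simp add: A_def index_block_def)
  have Ah: "(A *\<^sub>v h) $ i = (if i = n - 1 then L n (Suc n) * scale (Suc n) else 0)" if "i < n" for i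
  proof -
    have "(A *\<^sub>v h) $ i = (\<Sum>j<n. A $$ (i, j) * scale (Suc j))"
      using that carrier_matD[OF A] by (simp add: scalar_prod_def h_def lessThan_atLeast0)
    also have "\<dots> = (\<Sum>j<n. (if i = j then scale (Suc j) else 0) - L (Suc i) (Suc j) * scale (Suc j))"
      using that by (intro sum.cong) (auto simp: A_entry algebra_simps)
    also have "\<dots> = scale (Suc i) - (\<Sum>j<n. L (Suc i) (Suc j) * scale (Suc j))"
      using that by (simp add: sum_subtractf)
    \<comment> \<open>The term \<open>z = 0\<close> may be added, since \<open>scale 0 = 0\<close>.\<close>
    also have "(\<Sum>j<n. L (Suc i) (Suc j) * scale (Suc j)) = (\<Sum>z\<le>n. L (Suc i) z * scale z)"
      by (simp add: sum.lessThan_Suc_shift lessThan_Suc_atMost[symmetric] del: sum.lessThan_Suc)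
    also have "scale (Suc i) - \<dots> = (if i = n - 1 then L n (Suc n) * scale (Suc n) else 0)"
    proof (cases "i = n - 1")
      case True
      then have "Suc i = n"
        using False by simp
      then show ?thesis
        using scale_harmonic[of n] True by simp
    next
      case i: False
      have "(\<Sum>z\<le>n. L (Suc i) z * scale z) = (\<Sum>z\<le>Suc (Suc i). L (Suc i) z * scale z)"
        using that i by (intro sum.mono_neutral_right) (auto simp: zero_above)
      then show ?thesis
        using scale_harmonic[of "Suc i"] i by simp
    qed
    finally show ?thesis .
  qed
  define R where "R = replace_col A (A *\<^sub>v h) 0"
  have R: "R \<in> carrier_mat n n"
    using A by (simp add: R_def replace_col_def)
  have R_entry: "R $$ (i, j) = (if j = 0 then (A *\<^sub>v h) $ i else A $$ (i, j))" if "i < n" "j < n" for i j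
    using that A by (simp add: R_def replace_col_def)
  have "det_Id_minus_block L 1 n = det A"
    by (simp add: det_Id_minus_block_def A_def)
  also have "\<dots> = h $ 0 * det A"
    using False by (simp add: h_def)
  also have "\<dots> = det R"
    unfolding R_def using False by (intro cramer_lemma_mat[OF A, symmetric]) (auto simp: h_def)
  also have "\<dots> = (\<Sum>i<n. R $$ (i, 0) * cofactor R i 0)"
    using laplace_expansion_column[OF R, of 0] False by simp
  also have "\<dots> = (\<Sum>i<n. if i = n - 1 then L n (Suc n) * scale (Suc n) * cofactor R i 0 else 0)"
    using False by (intro sum.cong) (auto simp: R_entry Ah)
  also have "\<dots> = L n (Suc n) * scale (Suc n) * cofactor R (n - 1) 0"
    using False by simp
  also have "cofactor R (n - 1) 0 = (-1) ^ (n - 1) * det (mat_delete R (n - 1) 0)"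
    by (simp add: cofactor_def)
  also have "det (mat_delete R (n - 1) 0) = (\<Prod>i<n - 1. - L (Suc i) (Suc (Suc i)))"
  proof -
    have entry: "mat_delete R (n - 1) 0 $$ (i, j) = A $$ (i, Suc j)" if "i < n - 1" "j < n - 1" for i j
      using that R by (simp add: mat_delete_def R_entry)
    have C: "mat_delete R (n - 1) 0 \<in> carrier_mat (n - 1) (n - 1)"
      using R by (rule mat_delete_carrier)
    have "det (mat_delete R (n - 1) 0) = prod_list (diag_mat (mat_delete R (n - 1) 0))"
      using C by (intro det_lower_triangular[of "n - 1"])
        (auto simp: entry A_entry zero_above simp del: One_nat_def)
    also have "\<dots> = (\<Prod>i<n - 1. mat_delete R (n - 1) 0 $$ (i, i))"
      using carrier_matD[OF C]
      by (simp add: diag_mat_def prod.list_conv_set_nth lessThan_atLeast0 del: One_nat_def)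
    also have "\<dots> = (\<Prod>i<n - 1. - L (Suc i) (Suc (Suc i)))"
      by (intro prod.cong) (auto simp: entry A_entry simp del: One_nat_def)
    finally show ?thesis .
  qed
  also have "(-1) ^ (n - 1) * (\<Prod>i<n - 1. - L (Suc i) (Suc (Suc i))) =
      (\<Prod>i<n - 1. L (Suc i) (Suc (Suc i)))"
    by (simp add: prod_uminus power_mult_distrib[symmetric] mult.assoc[symmetric])
  also have "L n (Suc n) * scale (Suc n) * (\<Prod>i<n - 1. L (Suc i) (Suc (Suc i))) =
      scale (Suc n) * (\<Prod>j=1..n. L j (j + 1))"
    using False by (cases n) (simp_all add: prod.atLeast1_atMost_eq)
  finally show ?thesis .
qed

lemma prod_up_pos: "0 < (\<Prod>j\<in>J. L j (j + 1))"
  using up by (intro prod_pos) simp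

lemma det_pos: "det_Id_minus_block L 1 n > 0"
  using scale_ge_1[of "Suc n"] prod_up_pos[of "{1..n}"] unfolding det_eq_scale by simp

lemma scale_eq_det:
  assumes "0 < b"
  shows "1 / scale b = (\<Prod>j=1..b - 1. L j (j + 1)) / det_Id_minus_block L 1 (b - 1)"
  using assms prod_up_pos[of "{1..b - 1}"] unfolding det_eq_scale 
    by (simp del: prod_zero_iff)

lemma scale_ratio_eq_det:
  assumes "0 < x" "x < b"
  shows "scale x / scale b = det_Id_minus_block L 1 (x - 1) / det_Id_minus_block L 1 (b - 1) *
    (\<Prod>j=x..b - 1. L j (j + 1))"
proof -
  have "{1..b - 1} = {1..x - 1} \<union> {x..b - 1}"
    using assms by auto
  then have "(\<Prod>j=1..b - 1. L j (j + 1)) = (\<Prod>j=1..x - 1. L j (j + 1)) * (\<Prod>j=x..b - 1. L j (j + 1))"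
    using assms by (simp add: prod.union_disjoint)
  then show ?thesis
    using assms prod_up_pos[of "{1..x - 1}"] prod_up_pos[of "{x..b - 1}"] unfolding det_eq_scale 
    by (simp del: prod_zero_iff)
qed

section \<open>Exit probabilities and recurrence\<close>

lemma hitting_probability_first_step:
  "hitting_probability L T A x =
    (\<Sum>z\<le>Suc x. L x z * (if z \<in> A then 0 else if z \<in> T then 1 else hitting_probability L T A z))"
proof -
  have "(\<lambda>n. hit_prob L T A (Suc n) x) \<longlonglongrightarrow>
      (\<Sum>z\<le>Suc x. L x z * (if z \<in> A then 0 else if z \<in> T then 1 else hitting_probability L T A z))"
    unfolding hit_prob.simps row_suminf
    by (intro tendsto_sum tendsto_mult tendsto_const) (auto intro: hit_prob_tendsto transition)
  then show ?thesis
    using LIMSEQ_unique[OF LIMSEQ_Suc[OF hit_prob_tendsto[OF transition]]] by blast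
qed

lemma hitting_probability_bounds:
  "0 \<le> hitting_probability L T A x" "hitting_probability L T A x \<le> 1"
  unfolding hitting_probability_def
  by (auto intro: prob_space.prob_le_1 prob_space_chain_law)

text \<open>The exit probability, set to \<open>0\<close> at \<open>0\<close> and to \<open>1\<close> at \<open>b\<close>, and \<open>scale / scale b\<close> are harmonic
  strictly between \<open>0\<close> and \<open>b\<close> and agree at both ends, so the maximum principle applies to their difference and to
  its negative.\<close>

lemma hitting_probability_eq_scale:
  assumes "0 < x" "x < b"
  shows "hitting_probability L {b} {0} x = scale x / scale b"
proof -
  define v where "v = (\<lambda>z. if z \<in> {0} then 0 else if z \<in> {b} then 1 else hitting_probability L {b} {0} z)"
  have v: "v y = (\<Sum>z\<le>Suc y. L y z * v z)" if "0 < y" "y < b" for y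
    using that hitting_probability_first_step[of "{b}" "{0}" y] by (simp add: v_def del: sum.atMost_Suc)
  have h: "scale y / scale b = (\<Sum>z\<le>Suc y. L y z * (scale z / scale b))" if "0 < y" for y
    using scale_harmonic[OF that] by (simp add: sum_divide_distrib[symmetric] del: sum.atMost_Suc)
  have b: "scale b \<noteq> 0" "v 0 = 0" "v b = 1"
    using assms scale_ge_1[of b] by (auto simp: v_def)
  define d where "d = (\<lambda>z. v z - scale z / scale b)"
  have d: "d y = (\<Sum>z\<le>Suc y. L y z * d z)" if "0 < y" "y < b" for y
    using v[OF that] h[OF that(1)] by (simp add: d_def right_diff_distrib sum_subtractf del: sum.atMost_Suc)
  have "d x \<le> 0"
    by (rule maximum_principle[of b]) (use assms b d in \<open>auto simp: d_def simp del: sum.atMost_Suc\<close>)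
  moreover have "- d x \<le> 0"
    by (rule maximum_principle[of b "\<lambda>z. - d z"])
      (use assms b d in \<open>auto simp: sum_negf simp del: sum.atMost_Suc, auto simp: d_def\<close>)
  ultimately show ?thesis
    using assms by (simp add: d_def v_def)
qed

text \<open>For every horizon the probability of hitting \<open>0\<close> from \<open>x > 0\<close> is at most \<open>1 - scale x / H\<close>,
  because this function is harmonic in \<open>x > 0\<close> and dominates it at the start of the recursion and
  at \<open>0\<close>. So from \<open>0\<close> the chain may step to \<open>1\<close> and, with positive probability, never return.\<close>

lemma not_recurrent_if_scale_bounded:
  assumes bounded: "\<And>x. scale x \<le> H"
  shows "\<not> recurrent L"
proof
  assume "recurrent L"
  define p where "p = hitting_probability L {0} {}"
  have "H > 0"
    using bounded[of 1] by simp
  have le: "hit_prob L {0} {} n x \<le> 1 - scale x / H" if "0 < x" for n x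
    using that
  proof (induction n arbitrary: x)
    case 0
    then show ?case
      using bounded[of x] \<open>H > 0\<close> by simp
  next
    case (Suc n)
    have "hit_prob L {0} {} (Suc n) x \<le> (\<Sum>z\<le>Suc x. L x z * (1 - scale z / H))"
      unfolding hit_prob.simps row_suminf
      using Suc.IH by (intro sum_mono mult_left_mono nonneg) auto
    also have "\<dots> = 1 - scale x / H"
      using scale_harmonic[OF Suc.prems] row_sum[of x]
      by (simp add: right_diff_distrib sum_subtractf sum_divide_distrib[symmetric] del: sum.atMost_Suc)
    finally show ?case .
  qed
  have "p 1 \<le> 1 - 1 / H"
    unfolding p_def
    by (rule LIMSEQ_le_const2[OF hit_prob_tendsto[OF transition]]) (use le[of 1] in auto)
  then have "p 1 < 1"
    using \<open>H > 0\<close> by (smt (verit) divide_pos_pos)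
  moreover have "p 0 = L 0 0 + L 0 1 * p 1"
    using hitting_probability_first_step[of "{0}" "{}" 0] by (simp add: p_def)
  moreover have "p 0 = 1" "L 0 0 + L 0 1 = 1"
    using \<open>recurrent L\<close> row_sum[of 0] by (auto simp: recurrent_iff p_def)
  ultimately show False
    using up[of 0] by (smt (verit) One_nat_def mult_less_cancel_left2)
qed

text \<open>The probability \<open>g\<close> of avoiding \<open>i\<close> forever is harmonic except at \<open>i\<close>, where it vanishes, so it
  is subharmonic everywhere. A bounded function that is subharmonic on \<open>x > 0\<close> attains its supremum
  at \<open>0\<close>, since any positive multiple of \<open>scale\<close> exceeds its bound far out.\<close>

lemma recurrent_if_scale_unbounded:
  assumes unbounded: "filterlim scale at_top sequentially"
  shows "recurrent L"
  unfolding recurrent_iff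
proof
  fix i
  define g where "g = (\<lambda>z. if z = i then 0 else 1 - hitting_probability L {i} {} z)"
  have first_step: "1 - hitting_probability L {i} {} x = (\<Sum>z\<le>Suc x. L x z * g z)" for x
  proof -
    have "(\<Sum>z\<le>Suc x. L x z * (if z = i then 1 else hitting_probability L {i} {} z)) =
        (\<Sum>z\<le>Suc x. L x z * (1 - g z))"
      by (intro sum.cong) (auto simp: g_def)
    then show ?thesis
      using hitting_probability_first_step[of "{i}" "{}" x] row_sum[of x]
      by (simp add: right_diff_distrib sum_subtractf del: sum.atMost_Suc)
  qed
  have g_bounds: "0 \<le> g x" "g x \<le> 1" for x
    using hitting_probability_bounds[of "{i}" "{}" x] by (auto simp: g_def)
  have sub: "g x \<le> (\<Sum>z\<le>Suc x. L x z * g z)" for x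
  proof (cases "x = i")
    case True
    then have "g x = 0"
      by (simp add: g_def)
    also have "0 \<le> (\<Sum>z\<le>Suc x. L x z * g z)"
      by (intro sum_nonneg mult_nonneg_nonneg nonneg g_bounds)
    finally show ?thesis .
  next
    case False
    then show ?thesis
      using first_step[of x] by (simp add: g_def)
  qed
  \<comment> \<open>\<open>e * scale\<close> takes the value \<open>0\<close> at \<open>0\<close> and is at least \<open>1\<close> at any far \<open>b\<close>, so it
    dominates \<open>g - g 0\<close> at both ends of \<open>[0,b]\<close>.\<close>
  have below: "g x - g 0 \<le> e * scale x" if "e > 0" for e x
  proof -
    have "eventually (\<lambda>b. scale b \<ge> 1 / e) sequentially"
      using unbounded by (simp add: filterlim_at_top)
    then obtain b where b: "b \<ge> x" "scale b \<ge> 1 / e"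
      unfolding eventually_sequentially by (metis nle_le)
    have "g x - g 0 - e * scale x \<le> 0"
    proof (rule maximum_principle[of b])
      fix y assume y: "0 < y" "y < b"
      have "(\<Sum>z\<le>Suc y. L y z * (g z - g 0 - e * scale z)) =
          (\<Sum>z\<le>Suc y. L y z * g z) - (\<Sum>z\<le>Suc y. L y z) * g 0 - e * (\<Sum>z\<le>Suc y. L y z * scale z)"
        by (simp add: right_diff_distrib sum_subtractf sum_distrib_left sum_distrib_right mult_ac
            del: sum.atMost_Suc)
      then show "g y - g 0 - e * scale y \<le> (\<Sum>z\<le>Suc y. L y z * (g z - g 0 - e * scale z))"
        using sub[of y] unfolding row_sum scale_harmonic[OF y(1)] by simp
    next
      have "1 \<le> e * scale b"
        using b(2) that by (simp add: field_simps)
      then show "g b - g 0 - e * scale b \<le> 0"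
        using g_bounds(1)[of 0] g_bounds(2)[of b] by linarith
    qed (use b in auto)
    then show ?thesis
      by simp
  qed
  have max: "g x \<le> g 0" for x
  proof (rule field_le_epsilon)
    fix e :: real assume "e > 0"
    have "e / (scale x + 1) * scale x \<le> e"
      using \<open>e > 0\<close> scale_nonneg[of x] by (simp add: field_simps)
    moreover have "e / (scale x + 1) > 0"
      using \<open>e > 0\<close> scale_nonneg[of x] by simp
    ultimately show "g x \<le> g 0 + e"
      using below[of "e / (scale x + 1)" x] by linarith
  qed
  \<comment> \<open>The maximum at \<open>0\<close> moves up through every state, hence also to \<open>i\<close>, where \<open>g\<close> is \<open>0\<close>.\<close>
  have "g n = g 0" for n
  proof (induction n)
    case (Suc n)
    have "g (Suc n) = g n"
      by (rule maximum_moves_up) (use max Suc sub[of n] in \<open>auto simp del: sum.atMost_Suc\<close>)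
    then show ?case
      using Suc by simp
  qed simp
  then have "g x = 0" for x
    by (metis g_def)
  then show "hitting_probability L {i} {} i = 1"
    using first_step[of i] by simp
qed

theorem recurrent_iff_scale: "recurrent L \<longleftrightarrow> (\<lambda>b. 1 / scale b) \<longlonglongrightarrow> 0"
proof
  assume "recurrent L"
  then have "\<exists>x. Z \<le> scale x" for Z
    using not_recurrent_if_scale_bounded[of Z] by (meson nle_le)
  then have "filterlim scale at_top sequentially"
    unfolding filterlim_at_top eventually_sequentially by (meson monoD order_trans scale_mono)
  then show "(\<lambda>b. 1 / scale b) \<longlonglongrightarrow> 0"
    by (rule tendsto_divide_0[OF tendsto_const filterlim_at_top_imp_at_infinity])
next
  assume "(\<lambda>b. 1 / scale b) \<longlonglongrightarrow> 0"
  then have "filterlim (\<lambda>b. inverse (1 / scale b)) at_top sequentially"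
    by (rule filterlim_inverse_at_top)
      (auto intro!: eventually_sequentiallyI[of 1] scale_pos)
  then show "recurrent L"
    by (intro recurrent_if_scale_unbounded) simp
qed

end

text \<open>A skip-free chain can leave \<open>{..j}\<close> only by the step from \<open>j\<close> to \<open>j + 1\<close>, so without this step
  it would never get above \<open>j\<close>.\<close>

lemma irreducible_imp_up:
  assumes "transition_matrix L" "almost_lower_triangular L" "irreducible_matrix L"
  shows "L j (Suc j) > 0"
proof (rule ccontr)
  assume "\<not> L j (Suc j) > 0"
  have zero: "L i l = 0" if "i \<le> j" "j < l" for i l
  proof (rule ccontr)
    assume "L i l \<noteq> 0"
    then have "L i l > 0"
      using assms(1) by (simp add: transition_matrix_def less_le)
    moreover from this have "l \<le> i + 1"
      using assms(2) by (simp add: almost_lower_triangular_def)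
    then have "i = j" "l = Suc j"
      using that by auto
    ultimately show False
      using \<open>\<not> L j (Suc j) > 0\<close> by simp
  qed
  have "matrix_power L n i k = 0" if "i \<le> j" "j < k" for n i k
    using that
  proof (induction n arbitrary: i)
    case (Suc n)
    have "L i l * matrix_power L n l k = 0" for l
      using Suc zero[of i l] by (cases "l \<le> j") auto
    then show ?case
      by (simp only: matrix_power.simps suminf_zero)
  qed simp
  then show False
    using assms(3) unfolding irreducible_matrix_def by (metis lessI less_irrefl order_refl)
qed

theorem theorem2p12:
  fixes L :: "nat \<Rightarrow> nat \<Rightarrow> real"
    and M :: "'a measure"
    and Y :: "nat \<Rightarrow> 'a \<Rightarrow> nat"
  assumes "transition_matrix L"
    and "irreducible_matrix L"
    and "almost_lower_triangular L"
    and "markov_chain L M Y"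
  shows "(\<forall>b>0. det_Id_minus_block L 1 (b - 1) \<noteq> 0) \<and>
    (\<forall>x b. 0 < x \<and> x < b \<and> \<P>(\<omega> in M. Y 0 \<omega> = x) > 0 \<longrightarrow>
       exit_prob M Y b x =
         det_Id_minus_block L 1 (x - 1) / det_Id_minus_block L 1 (b - 1) * (\<Prod>j=x..b - 1. L j (j + 1))) \<and>
    (\<P>(\<omega> in M. Y 0 \<omega> = 1) > 0 \<longrightarrow>
       (recurrent L \<longleftrightarrow> (\<lambda>b. exit_prob M Y b 1) \<longlonglongrightarrow> 0)) \<and>
    (recurrent L \<longleftrightarrow>
       (\<lambda>b. (\<Prod>j=1..b - 1. L j (j + 1)) / det_Id_minus_block L 1 (b - 1)) \<longlonglongrightarrow> 0)"
proof -
  interpret upward_skip_free L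
    by unfold_locales (use assms irreducible_imp_up in auto)
  have exit: "exit_prob M Y b x = scale x / scale b"
    if "0 < x" "x < b" "\<P>(\<omega> in M. Y 0 \<omega> = x) > 0" for x b
    unfolding exit_prob_def
    using cond_prob_eq_hitting_probability[OF assms(1,4) that(3)]
      hitting_probability_eq_scale[OF that(1,2)] by simp
  have "(\<lambda>b. exit_prob M Y b 1) \<longlonglongrightarrow> 0 \<longleftrightarrow> recurrent L" if "\<P>(\<omega> in M. Y 0 \<omega> = 1) > 0"
    unfolding recurrent_iff_scale
    by (rule filterlim_cong[OF refl refl])
      (use exit[OF _ _ that] in \<open>auto intro!: eventually_sequentiallyI[of 2]\<close>)
  moreover have "(\<lambda>b. (\<Prod>j=1..b - 1. L j (j + 1)) / det_Id_minus_block L 1 (b - 1)) \<longlonglongrightarrow> 0 \<longleftrightarrow>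
      recurrent L"
    unfolding recurrent_iff_scale
    by (rule filterlim_cong[OF refl refl])
      (auto intro!: eventually_sequentiallyI[of 1] simp: scale_eq_det simp del: One_nat_def)
  moreover have "exit_prob M Y b x =
      det_Id_minus_block L 1 (x - 1) / det_Id_minus_block L 1 (b - 1) * (\<Prod>j=x..b - 1. L j (j + 1))"
    if "0 < x" "x < b" "\<P>(\<omega> in M. Y 0 \<omega> = x) > 0" for x b
    using exit[OF that] scale_ratio_eq_det[OF that(1,2)] by simp
  moreover have "det_Id_minus_block L 1 n \<noteq> 0" for n
    using det_pos[of n] by simp
  ultimately show ?thesis
    by blast
qed

end
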